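(* Let $n\ge 2$, let $N=\{1,\dots,n\}$, and let $\alpha,\beta$ be nonempty index sets with $\alpha\cup\beta=N$ and $\alpha\cap\beta=\emptyset$. Let $A=[a_{ij}]\in\mathbb{C}^{n\times n}$. Suppose that for each $i\in\alpha$ and each $j\in\beta$ all of the following four conditions hold: (I) $|a_{ii}|>r_i^\alpha(A)$; (II) $|a_{jj}|>r_j^\beta(A)$; (III) $(|a_{ii}|-r_i^\alpha(A))(|a_{jj}|-r_j^\beta(A))>r_i^\beta(A)\,r_j^\alpha(A)$ or $(|a_{ii}|+r_i^j(A))(|a_{jj}|+r_j^\beta(A))<|a_{ij}|\,(2|a_{ji}|-r_j^\alpha(A))$; (IV) $(|a_{ii}|-r_i^\alpha(A))(|a_{jj}|-r_j^\beta(A))>r_i^\beta(A)\,r_j^\alpha(A)$ or $(|a_{jj}|+r_j^i(A))(|a_{ii}|+r_i^\alpha(A))<|a_{ji}|\,(2|a_{ij}|-r_i^\beta(A))$. Then $A$ is nonsingular.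
   Context: For $A=[a_{ij}]\in\mathbb{C}^{n\times n}$ and $i\in N=\{1,\dots,n\}$, the partial absolute deleted row sums are $$r_i^\alpha(A)=\sum_{k\in\alpha,\ k\ne i}|a_{ik}|,\qquad r_i^\beta(A)=\sum_{k\in\beta,\ k\ne i}|a_{ik}|,$$ with empty sums equal to $0$ (so $r_{i_0}^\alpha(A)=0$ if $\alpha=\{i_0\}$, and $r_{i_0}^\beta(A)=0$ if $\beta=\{i_0\}$). For $i\ne j$ in $N$, $$r_i^j(A)=\sum_{k\in N,\ k\ne i,j}|a_{ik}|.$$ *)

theory Defs
  imports "HOL-Analysis.Analysis"
begin

(* Partial absolute deleted row sum of row i over S; the diagonal entry is always omitted,
   whether or not i belongs to S. *)
definition partial_row_sum :: "complex^'n^'n \<Rightarrow> 'n set \<Rightarrow> 'n::finite \<Rightarrow> real" where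
  "partial_row_sum A S i = (\<Sum>k\<in>S - {i}. cmod (A $ i $ k))"

(* In row i, the entries of columns i and j are omitted. *)
definition row_sum_except :: "complex^'n^'n \<Rightarrow> 'n::finite \<Rightarrow> 'n \<Rightarrow> real" where
  "row_sum_except A i j = (\<Sum>k\<in>UNIV - {i, j}. cmod (A $ i $ k))"

end

theory Submission
  imports Defs
begin

text \<open>
  Let \<open>A *v x = 0\<close> with \<open>x \<noteq> 0\<close>, and let \<open>x\<close> be largest in modulus on \<open>\<alpha>\<close> at \<open>p\<close> and on \<open>\<beta>\<close>
  at \<open>q\<close>. Estimating the diagonal terms of rows \<open>p\<close> and \<open>q\<close> (lemma \<open>dominant_diagonal_bound\<close>)
  gives
    \<open>(|a\<^sub>p\<^sub>p| - r\<^sub>p\<^sup>\<alpha>) |x\<^sub>p| \<le> r\<^sub>p\<^sup>\<beta> |x\<^sub>q|\<close> and \<open>(|a\<^sub>q\<^sub>q| - r\<^sub>q\<^sup>\<beta>) |x\<^sub>q| \<le> r\<^sub>q\<^sup>\<alpha> |x\<^sub>p|\<close>.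
  By (I) and (II) the factors on the left are positive, so neither \<open>x\<^sub>p\<close> nor \<open>x\<^sub>q\<close> can vanish
  without the other; as \<open>x \<noteq> 0\<close>, both are nonzero. The product of the two
  inequalities then refutes the first alternative of (III) and (IV) at \<open>(p, q)\<close>.

  The second alternatives are refuted by estimating the off-diagonal terms \<open>a\<^sub>p\<^sub>q x\<^sub>q\<close> and
  \<open>a\<^sub>q\<^sub>p x\<^sub>p\<close> instead (lemmas \<open>cross_block_bound\<close> and \<open>off_diagonal_bound\<close>). One of these
  estimates needs the entry of \<open>x\<close> on the diagonal of its row to be the largest in modulus of all
  entries. Hence (III) is refuted if \<open>|x\<^sub>q| \<le> |x\<^sub>p|\<close> and (IV) if \<open>|x\<^sub>p| \<le> |x\<^sub>q|\<close>, and the two cases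
  differ only by exchanging \<open>\<alpha>\<close> and \<open>\<beta>\<close> (lemma \<open>off_diagonal_product_bound\<close>).
\<close>

lemma kernel_row_bound:
  fixes A :: "complex^'n^'n::finite"
  assumes "A *v x = 0"
  shows "cmod (A $ i $ j) * cmod (x $ j) \<le> (\<Sum>k\<in>UNIV - {j}. cmod (A $ i $ k) * cmod (x $ k))"
proof -
  have "(\<Sum>k\<in>UNIV. A $ i $ k * x $ k) = 0"
    using assms by (simp add: matrix_vector_mult_def vec_eq_iff)
  then have "A $ i $ j * x $ j = - (\<Sum>k\<in>UNIV - {j}. A $ i $ k * x $ k)"
    by (simp add: sum.remove[of UNIV j] eq_neg_iff_add_eq_0)
  then have "cmod (A $ i $ j * x $ j) = cmod (\<Sum>k\<in>UNIV - {j}. A $ i $ k * x $ k)"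
    by simp
  also have "\<dots> \<le> (\<Sum>k\<in>UNIV - {j}. cmod (A $ i $ k * x $ k))"
    by (rule norm_sum)
  finally show ?thesis
    by (simp add: norm_mult)
qed

lemma kernel_row_bound_partition:
  fixes A :: "complex^'n^'n::finite"
  assumes "A *v x = 0" and "S \<union> T = UNIV" and "S \<inter> T = {}" and "j \<in> S"
  shows "cmod (A $ i $ j) * cmod (x $ j)
    \<le> (\<Sum>k\<in>S - {j}. cmod (A $ i $ k) * cmod (x $ k)) + (\<Sum>k\<in>T. cmod (A $ i $ k) * cmod (x $ k))"
proof -
  have "UNIV - {j} = (S - {j}) \<union> T"
    using assms by auto
  moreover have "(S - {j}) \<inter> T = {}"
    using assms by auto
  ultimately show ?thesis
    using kernel_row_bound[OF assms(1), of i j] by (simp add: sum.union_disjoint)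
qed

lemma weighted_row_sum_le:
  fixes A :: "complex^'n^'n::finite"
  assumes "\<And>k. k \<in> S \<Longrightarrow> cmod (x $ k) \<le> b"
  shows "(\<Sum>k\<in>S. cmod (A $ i $ k) * cmod (x $ k)) \<le> (\<Sum>k\<in>S. cmod (A $ i $ k)) * b"
  unfolding sum_distrib_right using assms by (intro sum_mono mult_left_mono) auto

lemma dominant_diagonal_bound:
  fixes A :: "complex^'n^'n::finite"
  assumes ker: "A *v x = 0" and part: "S \<union> T = UNIV" "S \<inter> T = {}" and p: "p \<in> S"
    and maxS: "\<And>k. k \<in> S \<Longrightarrow> cmod (x $ k) \<le> cmod (x $ p)"
    and maxT: "\<And>k. k \<in> T \<Longrightarrow> cmod (x $ k) \<le> cmod (x $ q)"
  shows "(cmod (A $ p $ p) - partial_row_sum A S p) * cmod (x $ p)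
    \<le> partial_row_sum A T p * cmod (x $ q)"
proof -
  have "(\<Sum>k\<in>S - {p}. cmod (A $ p $ k) * cmod (x $ k)) \<le> partial_row_sum A S p * cmod (x $ p)"
    unfolding partial_row_sum_def using maxS by (intro weighted_row_sum_le) auto
  moreover have "T - {p} = T"
    using part p by auto
  then have "(\<Sum>k\<in>T. cmod (A $ p $ k) * cmod (x $ k)) \<le> partial_row_sum A T p * cmod (x $ q)"
    unfolding partial_row_sum_def using weighted_row_sum_le[of T x "cmod (x $ q)" A p] maxT by simp
  ultimately show ?thesis
    using kernel_row_bound_partition[OF ker part p, of p] by (simp add: left_diff_distrib)
qed

text \<open>
  The factor 2 appears because the deleted sum of row \<open>q\<close> over \<open>S\<close> contains the entry in column
  \<open>p\<close>, which the estimate of \<open>a\<^sub>q\<^sub>p x\<^sub>p\<close> has to leave out.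
\<close>

lemma cross_block_bound:
  fixes A :: "complex^'n^'n::finite"
  assumes ker: "A *v x = 0" and part: "S \<union> T = UNIV" "S \<inter> T = {}" and p: "p \<in> S" and q: "q \<in> T"
    and maxS: "\<And>k. k \<in> S \<Longrightarrow> cmod (x $ k) \<le> cmod (x $ p)"
    and maxT: "\<And>k. k \<in> T \<Longrightarrow> cmod (x $ k) \<le> cmod (x $ q)"
  shows "(2 * cmod (A $ q $ p) - partial_row_sum A S q) * cmod (x $ p)
    \<le> (cmod (A $ q $ q) + partial_row_sum A T q) * cmod (x $ q)"
proof -
  have "S - {q} = S"
    using part q by auto
  then have colS: "(\<Sum>k\<in>S - {p}. cmod (A $ q $ k)) = partial_row_sum A S q - cmod (A $ q $ p)"
    unfolding partial_row_sum_def using p by (simp add: sum.remove[of S p])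
  have colT: "(\<Sum>k\<in>T. cmod (A $ q $ k)) = cmod (A $ q $ q) + partial_row_sum A T q"
    unfolding partial_row_sum_def using q by (simp add: sum.remove[of T q])
  have "(\<Sum>k\<in>S - {p}. cmod (A $ q $ k) * cmod (x $ k))
      \<le> (partial_row_sum A S q - cmod (A $ q $ p)) * cmod (x $ p)"
    unfolding colS[symmetric] using maxS by (intro weighted_row_sum_le) auto
  moreover have "(\<Sum>k\<in>T. cmod (A $ q $ k) * cmod (x $ k))
      \<le> (cmod (A $ q $ q) + partial_row_sum A T q) * cmod (x $ q)"
    unfolding colT[symmetric] using maxT by (intro weighted_row_sum_le)
  ultimately have "cmod (A $ q $ p) * cmod (x $ p)
      \<le> (partial_row_sum A S q - cmod (A $ q $ p)) * cmod (x $ p)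
        + (cmod (A $ q $ q) + partial_row_sum A T q) * cmod (x $ q)"
    using kernel_row_bound_partition[OF ker part p, of q] by linarith
  then show ?thesis
    by (simp add: algebra_simps)
qed

lemma off_diagonal_bound:
  fixes A :: "complex^'n^'n::finite"
  assumes ker: "A *v x = 0" and ne: "p \<noteq> q"
    and max: "\<And>k. cmod (x $ k) \<le> cmod (x $ p)"
  shows "cmod (A $ p $ q) * cmod (x $ q) \<le> (cmod (A $ p $ p) + row_sum_except A p q) * cmod (x $ p)"
proof -
  have "UNIV - {q} = insert p (UNIV - {p, q})"
    using ne by auto
  then have "(\<Sum>k\<in>UNIV - {q}. cmod (A $ p $ k)) = cmod (A $ p $ p) + row_sum_except A p q"
    by (simp add: row_sum_except_def)
  then show ?thesis
    using kernel_row_bound[OF ker, of p q] weighted_row_sum_le[of "UNIV - {q}" x "cmod (x $ p)" A p] max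
    by simp
qed

text \<open>
  The product of the two preceding estimates, divided by \<open>|x\<^sub>p| |x\<^sub>q|\<close>, is the negation of the
  second alternative in (III), and in (IV) after exchanging the two blocks. Multiplying them
  takes \<open>2 |a\<^sub>q\<^sub>p| \<ge> r\<^sub>q\<^sup>S\<close>; otherwise the left-hand side is at most zero.
\<close>

lemma off_diagonal_product_bound:
  fixes A :: "complex^'n^'n::finite"
  assumes ker: "A *v x = 0" and part: "S \<union> T = UNIV" "S \<inter> T = {}" and p: "p \<in> S" and q: "q \<in> T"
    and maxS: "\<And>k. k \<in> S \<Longrightarrow> cmod (x $ k) \<le> cmod (x $ p)"
    and maxT: "\<And>k. k \<in> T \<Longrightarrow> cmod (x $ k) \<le> cmod (x $ q)"
    and le: "cmod (x $ q) \<le> cmod (x $ p)" and pos: "0 < cmod (x $ q)"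
  shows "cmod (A $ p $ q) * (2 * cmod (A $ q $ p) - partial_row_sum A S q)
    \<le> (cmod (A $ p $ p) + row_sum_except A p q) * (cmod (A $ q $ q) + partial_row_sum A T q)"
    (is "?a * ?d \<le> ?b * ?c")
proof -
  have nonneg: "0 \<le> ?b" "0 \<le> ?c"
    by (simp_all add: row_sum_except_def partial_row_sum_def sum_nonneg)
  show ?thesis
  proof (cases "0 \<le> ?d")
    case True
    have "cmod (x $ k) \<le> cmod (x $ p)" for k
    proof (cases "k \<in> S")
      case False
      then have "k \<in> T"
        using part(1) by auto
      then show ?thesis
        using maxT le order_trans by blast
    qed (rule maxS)
    moreover have "p \<noteq> q"
      using part p q by auto
    ultimately have "?a * cmod (x $ q) \<le> ?b * cmod (x $ p)"
      using off_diagonal_bound[OF ker] by blast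
    moreover have "?d * cmod (x $ p) \<le> ?c * cmod (x $ q)"
      by (rule cross_block_bound[OF ker part p q maxS maxT])
    ultimately have "(?a * cmod (x $ q)) * (?d * cmod (x $ p)) \<le> (?b * cmod (x $ p)) * (?c * cmod (x $ q))"
      by (rule mult_mono) (use True nonneg in auto)
    then have "(?a * ?d) * (cmod (x $ p) * cmod (x $ q)) \<le> (?b * ?c) * (cmod (x $ p) * cmod (x $ q))"
      by (simp add: mult_ac)
    moreover have "0 < cmod (x $ p) * cmod (x $ q)"
      using pos le by (intro mult_pos_pos) auto
    ultimately show ?thesis
      by (rule mult_right_le_imp_le)
  next
    case False
    then have "?a * ?d \<le> 0"
      by (simp add: mult_nonneg_nonpos)
    also have "\<dots> \<le> ?b * ?c"
      using nonneg by simp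
    finally show ?thesis .
  qed
qed

lemma exists_max_modulus:
  fixes x :: "complex^'n::finite"
  assumes "S \<noteq> {}"
  obtains p where "p \<in> S" and "\<And>k. k \<in> S \<Longrightarrow> cmod (x $ k) \<le> cmod (x $ p)"
proof -
  have "Max ((\<lambda>k. cmod (x $ k)) ` S) \<in> (\<lambda>k. cmod (x $ k)) ` S"
    using assms by (intro Max_in) auto
  then obtain p where "p \<in> S" "Max ((\<lambda>k. cmod (x $ k)) ` S) = cmod (x $ p)"
    by auto
  then show thesis
    using that[of p] by (metis Max_ge finite finite_imageI imageI)
qed

theorem corollary1:
  fixes A :: "complex^'n^'n"
    and \<alpha> \<beta> :: "'n::finite set"
  assumes "CARD('n) \<ge> 2"
    and "\<alpha> \<noteq> {}" and "\<beta> \<noteq> {}"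
    and "\<alpha> \<union> \<beta> = UNIV" and "\<alpha> \<inter> \<beta> = {}"
    and I: "\<And>i j. i \<in> \<alpha> \<Longrightarrow> j \<in> \<beta> \<Longrightarrow>
      cmod (A $ i $ i) > partial_row_sum A \<alpha> i"
    and II: "\<And>i j. i \<in> \<alpha> \<Longrightarrow> j \<in> \<beta> \<Longrightarrow>
      cmod (A $ j $ j) > partial_row_sum A \<beta> j"
    and III: "\<And>i j. i \<in> \<alpha> \<Longrightarrow> j \<in> \<beta> \<Longrightarrow>
      (cmod (A $ i $ i) - partial_row_sum A \<alpha> i) * (cmod (A $ j $ j) - partial_row_sum A \<beta> j)
        > partial_row_sum A \<beta> i * partial_row_sum A \<alpha> j \<or>
      (cmod (A $ i $ i) + row_sum_except A i j) * (cmod (A $ j $ j) + partial_row_sum A \<beta> j)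
        < cmod (A $ i $ j) * (2 * cmod (A $ j $ i) - partial_row_sum A \<alpha> j)"
    and IV: "\<And>i j. i \<in> \<alpha> \<Longrightarrow> j \<in> \<beta> \<Longrightarrow>
      (cmod (A $ i $ i) - partial_row_sum A \<alpha> i) * (cmod (A $ j $ j) - partial_row_sum A \<beta> j)
        > partial_row_sum A \<beta> i * partial_row_sum A \<alpha> j \<or>
      (cmod (A $ j $ j) + row_sum_except A j i) * (cmod (A $ i $ i) + partial_row_sum A \<alpha> i)
        < cmod (A $ j $ i) * (2 * cmod (A $ i $ j) - partial_row_sum A \<beta> i)"
  shows "invertible A"
proof -
  have "x = 0" if ker: "A *v x = 0" for x
  proof (rule ccontr)
    assume "x \<noteq> 0"
    obtain p where p: "p \<in> \<alpha>" and maxp: "\<And>k. k \<in> \<alpha> \<Longrightarrow> cmod (x $ k) \<le> cmod (x $ p)"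
      using exists_max_modulus[OF \<open>\<alpha> \<noteq> {}\<close>] by metis
    obtain q where q: "q \<in> \<beta>" and maxq: "\<And>k. k \<in> \<beta> \<Longrightarrow> cmod (x $ k) \<le> cmod (x $ q)"
      using exists_max_modulus[OF \<open>\<beta> \<noteq> {}\<close>] by metis
    note part = \<open>\<alpha> \<union> \<beta> = UNIV\<close> \<open>\<alpha> \<inter> \<beta> = {}\<close>
    have part': "\<beta> \<union> \<alpha> = UNIV" "\<beta> \<inter> \<alpha> = {}"
      using part by auto
    let ?u = "cmod (x $ p)" and ?v = "cmod (x $ q)"
    let ?c = "cmod (A $ p $ p) - partial_row_sum A \<alpha> p"
    let ?d = "cmod (A $ q $ q) - partial_row_sum A \<beta> q"
    have pos: "0 < ?c" "0 < ?d"
      using I[OF p q] II[OF p q] by auto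
    have row_p: "?c * ?u \<le> partial_row_sum A \<beta> p * ?v"
      by (rule dominant_diagonal_bound[OF ker part p maxp maxq])
    have row_q: "?d * ?v \<le> partial_row_sum A \<alpha> q * ?u"
      by (rule dominant_diagonal_bound[OF ker part' q maxq maxp])
    have "?u \<noteq> 0 \<or> ?v \<noteq> 0"
    proof (rule ccontr)
      assume "\<not> ?thesis"
      then have "x $ k = 0" for k
        using maxp[of k] maxq[of k] part(1) by (cases "k \<in> \<alpha>") auto
      then show False
        using \<open>x \<noteq> 0\<close> by (simp add: vec_eq_iff)
    qed
    moreover have "?u = 0" if "?v = 0"
      using row_p pos(1) that by (simp add: mult_le_0_iff)
    moreover have "?v = 0" if "?u = 0"
      using row_q pos(2) that by (simp add: mult_le_0_iff)
    ultimately have upos: "0 < ?u" and vpos: "0 < ?v"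
      by auto
    have "(?c * ?u) * (?d * ?v) \<le> (partial_row_sum A \<beta> p * ?v) * (partial_row_sum A \<alpha> q * ?u)"
      using row_p row_q by (rule mult_mono) (use pos in \<open>auto simp: partial_row_sum_def sum_nonneg\<close>)
    then have "(?c * ?d) * (?u * ?v) \<le> (partial_row_sum A \<beta> p * partial_row_sum A \<alpha> q) * (?u * ?v)"
      by (simp add: mult_ac)
    then have no_first: "?c * ?d \<le> partial_row_sum A \<beta> p * partial_row_sum A \<alpha> q"
      using upos vpos by (rule mult_right_le_imp_le[OF _ mult_pos_pos])
    show False
    proof (cases "?v \<le> ?u")
      case True
      show False
        using off_diagonal_product_bound[OF ker part p q maxp maxq True vpos] III[OF p q] no_first
        by linarith
    next
      case False
      then have "?u \<le> ?v"
        by simp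
      show False
        using off_diagonal_product_bound[OF ker part' q p maxq maxp \<open>?u \<le> ?v\<close> upos] IV[OF p q] no_first
        by linarith
    qed
  qed
  then show ?thesis
    unfolding invertible_left_inverse matrix_left_invertible_ker by blast
qed

end
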